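(* Let $X$ be a real Banach space, let $K$ be a compact subset of the unit sphere $S_X$, and let $f\in C(K,X)$. Then $f$ is $nr$-right symmetric if and only if for every $k\in K$ the following conditions hold: (i) there exists $x^*\in J(k)$ such that $|x^*(f(k))|=\|f\|_w$; (ii) $f(k)$ is right symmetric with respect to $v_k(\cdot)$.
   Context: $S_X$ is the unit sphere of $X$, $X^*$ the dual of $X$. $C(K,X)$ is the space of continuous functions $f:K\to X$ (for the norm topologies). For $u\in S_X$: $J(u)=\{x^*\in S_{X^*}:x^*(u)=1\}$ and $v_u(x)=\sup_{x^*\in J(u)}|x^*(x)|$ for $x\in X$ (a semi-norm on $X$). Write $x\perp_{v_u}y$ if $v_u(x+\lambda y)\ge v_u(x)$ for all scalars $\lambda$. An element $x\in X$ is right symmetric with respect to $v_u(\cdot)$ if for every $y\in X$, $y\perp_{v_u}x$ implies $x\perp_{v_u}y$. $\Pi(K,X)=\{(k,x^* ):k\in K,\ x^*\in J(k)\}$ and, for $f\in C(K,X)$, $\|f\|_w=\sup\{|x^*(f(k))|:(k,x^* )\in\Pi(K,X)\}$ (a semi-norm on $C(K,X)$). Write $f\perp_w g$ if $\|f+\lambda g\|_w\ge\|f\|_w$ for all scalars $\lambda$. A function $f\in C(K,X)$ is $nr$-right symmetric if for every $g\in C(K,X)$, $g\perp_w f$ implies $f\perp_w g$. *)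

theory Defs
  imports "HOL-Analysis.Analysis"
begin

text \<open>The dual of a real normed space \<open>'a\<close> is \<open>'a \<Rightarrow>\<^sub>L real\<close> with its operator norm.\<close>

definition support_functionals :: "'a::real_normed_vector \<Rightarrow> ('a \<Rightarrow>\<^sub>L real) set"  ("J")
  where "J u = {\<phi> \<in> sphere 0 1. blinfun_apply \<phi> u = 1}"

definition v_seminorm :: "'a::real_normed_vector \<Rightarrow> 'a \<Rightarrow> real"
  where "v_seminorm u x = (SUP \<phi>\<in>J u. \<bar>blinfun_apply \<phi> x\<bar>)"

definition v_orthogonal :: "'a::real_normed_vector \<Rightarrow> 'a \<Rightarrow> 'a \<Rightarrow> bool"
  where "v_orthogonal u x y \<longleftrightarrow> (\<forall>c::real. v_seminorm u (x + c *\<^sub>R y) \<ge> v_seminorm u x)"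

definition v_right_symmetric :: "'a::real_normed_vector \<Rightarrow> 'a \<Rightarrow> bool"
  where "v_right_symmetric u x \<longleftrightarrow> (\<forall>y. v_orthogonal u y x \<longrightarrow> v_orthogonal u x y)"

definition Pi_pairs :: "'a::real_normed_vector set \<Rightarrow> ('a \<times> ('a \<Rightarrow>\<^sub>L real)) set"
  where "Pi_pairs K = {(k, \<phi>). k \<in> K \<and> \<phi> \<in> J k}"

text \<open>
  An element of \<open>C(K,X)\<close> is represented by a total function that is continuous on \<open>K\<close>;
  everything below depends only on its values on \<open>K\<close>.  For empty \<open>K\<close>, \<open>w_seminorm K\<close> is the
  unspecified real \<open>Sup {}\<close>, the same for every function, so that all functions are orthogonal
  to each other, as they are in the zero space.
\<close>

definition w_seminorm :: "'a::real_normed_vector set \<Rightarrow> ('a \<Rightarrow> 'a) \<Rightarrow> real"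
  where "w_seminorm K f = (SUP (k, \<phi>)\<in>Pi_pairs K. \<bar>blinfun_apply \<phi> (f k)\<bar>)"

definition w_orthogonal :: "'a::real_normed_vector set \<Rightarrow> ('a \<Rightarrow> 'a) \<Rightarrow> ('a \<Rightarrow> 'a) \<Rightarrow> bool"
  where "w_orthogonal K f g \<longleftrightarrow>
    (\<forall>c::real. w_seminorm K (\<lambda>k. f k + c *\<^sub>R g k) \<ge> w_seminorm K f)"

definition nr_right_symmetric :: "'a::real_normed_vector set \<Rightarrow> ('a \<Rightarrow> 'a) \<Rightarrow> bool"
  where "nr_right_symmetric K f \<longleftrightarrow>
    (\<forall>g. continuous_on K g \<longrightarrow> w_orthogonal K g f \<longrightarrow> w_orthogonal K f g)"

end

theory Submission
  imports Defs
begin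

text \<open>
  Write \<open>v\<^sub>k\<close> for \<open>v_seminorm k\<close>, \<open>w\<close> for \<open>w_seminorm K\<close> and \<open>M = w f\<close>.  Since
  \<open>w h\<close> is the supremum of \<open>v\<^sub>k (h k)\<close> over \<open>k \<in> K\<close>, the theorem compares a
  supremum of semi-norms with its members.  Two facts make such a comparison possible.
  First, the supremum that defines \<open>v\<^sub>k x\<close> is attained, and \<open>v\<^sub>k x\<close> is
  the limit of the difference quotients of the norm at \<open>k\<close> in the directions \<open>x\<close> and
  \<open>- x\<close>, whichever is larger (\<open>support_functional_ge\<close>, a consequence of the Hahn-Banach theorem).
  Attainment turns condition (i) into \<open>v\<^sub>k (f k) = M\<close>.  Second, the quotients are continuous
  in \<open>k\<close> and bound \<open>v\<^sub>k\<close> from above, so \<open>k \<mapsto> v\<^sub>k (h k)\<close> is upper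
  semicontinuous for continuous \<open>h\<close> (\<open>v_seminorm_upper_semicontinuous\<close>), and compactness of
  \<open>K\<close> is available.

  Sufficiency.  Orthogonality of \<open>g\<close> to \<open>f\<close> in \<open>C(K,X)\<close> need not be visible at a single point,
  but half of it is: compactness gives a \<open>k\<close> with
  \<open>v\<^sub>k (g k + s f k) \<ge> v\<^sub>k (g k)\<close> for all \<open>s \<ge> 0\<close>
  (\<open>w_orthogonal_ray_point\<close>).  The convex function
  \<open>s \<mapsto> v\<^sub>k (g k + s f k)\<close> then has a minimiser \<open>s \<le> 0\<close>, where
  \<open>h = g k + s f k\<close> is orthogonal to \<open>f k\<close>; by (ii) \<open>f k\<close> is orthogonal to \<open>h\<close>, and for
  \<open>t \<ge> 0\<close> the vector \<open>f k + t g k\<close> is \<open>f k\<close> plus a multiple of \<open>h\<close>, scaled by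
  \<open>1 - t s \<ge> 1\<close> (\<open>v_right_symmetric_ray\<close>).  Hence \<open>w (f + t g) \<ge> M\<close> for
  \<open>t \<ge> 0\<close>, and \<open>- g\<close> in place of \<open>g\<close> gives \<open>t \<le> 0\<close>.

  Necessity.  The witness against right symmetry always has the same shape: near a point
  \<open>k\<^sub>0\<close> it is a damped constant vector \<open>y\<close>, and away from \<open>k\<^sub>0\<close> it is
  \<open>- f / M\<close>.  If moving from \<open>f k\<^sub>0\<close> in the direction \<open>y\<close> brings
  \<open>v\<^sub>k\<^sub>0\<close> below \<open>M\<close>, then moving from \<open>f\<close> in the direction of this \<open>g\<close> lowers \<open>w\<close>,
  so \<open>f\<close> is not orthogonal to \<open>g\<close> (\<open>descent_direction\<close>).  It remains to choose \<open>y\<close> so that \<open>g\<close>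
  is orthogonal to \<open>f\<close>.  If (i) fails at \<open>k\<^sub>0\<close>, take \<open>y = k\<^sub>0\<close> or
  \<open>y = - k\<^sub>0\<close>: with the right sign, adding a positive multiple of \<open>f\<close> does not decrease
  \<open>w\<close> because of \<open>k\<^sub>0\<close>, and adding a negative one does not because of a norming point of \<open>f\<close>, where
  \<open>g = - f / M\<close>.  If (ii) fails at \<open>k\<^sub>0\<close>, take a multiple of a vector orthogonal to
  \<open>f k\<^sub>0\<close> to which \<open>f k\<^sub>0\<close> is not orthogonal.
\<close>

section \<open>Linear functionals below a sublinear one\<close>

definition sublinear :: "('a::real_vector \<Rightarrow> real) \<Rightarrow> bool"
  where "sublinear p \<longleftrightarrow> (\<forall>x y. p (x + y) \<le> p x + p y) \<and> (\<forall>c x. 0 < c \<longrightarrow> p (c *\<^sub>R x) = c * p x)"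

lemma sublinear_add: "sublinear p \<Longrightarrow> p (x + y) \<le> p x + p y"
  and sublinear_scale: "sublinear p \<Longrightarrow> 0 < c \<Longrightarrow> p (c *\<^sub>R x) = c * p x"
  by (auto simp: sublinear_def)

lemma sublinear_zero:
  assumes "sublinear p" shows "p 0 = 0"
  using sublinear_scale[OF assms, of 2 0] by simp

lemma sublinear_ge_neg:
  assumes "sublinear p" shows "- p (- x) \<le> p x"
  using sublinear_add[OF assms, of x "- x"] sublinear_zero[OF assms] by simp

text \<open>
  For \<open>a \<le> p x\<close>, this is the largest sublinear functional below \<open>p\<close> whose value at \<open>- x\<close>
  is at most \<open>- a\<close>: a linear functional below it is at least \<open>a\<close> at \<open>x\<close>.
\<close>

definition push_down :: "('a::real_vector \<Rightarrow> real) \<Rightarrow> 'a \<Rightarrow> real \<Rightarrow> 'a \<Rightarrow> real"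
  where "push_down p x a z = (INF t\<in>{0..}. p (z + t *\<^sub>R x) - t * a)"

text \<open>The infimum is over a set bounded from below; this is where \<open>a \<le> p x\<close> enters.\<close>

lemma push_down_lower:
  assumes p: "sublinear p" and a: "a \<le> p x" and t: "0 \<le> t"
  shows "- p (- z) \<le> p (z + t *\<^sub>R x) - t * a"
proof -
  have "t * a \<le> p (t *\<^sub>R x)"
    using a t sublinear_zero[OF p] sublinear_scale[OF p, of t x]
    by (cases "t = 0") auto
  also have "\<dots> \<le> p (z + t *\<^sub>R x) + p (- z)"
    using sublinear_add[OF p, of "z + t *\<^sub>R x" "- z"] by simp
  finally show ?thesis by simp
qed

lemma push_down_le:
  assumes "sublinear p" "a \<le> p x" "0 \<le> t"
  shows "push_down p x a z \<le> p (z + t *\<^sub>R x) - t * a"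
  unfolding push_down_def
  by (rule cINF_lower) (use push_down_lower[OF assms(1,2)] assms(3) in \<open>auto intro!: bdd_belowI2\<close>)

lemma push_down_greatest:
  assumes "\<And>t. 0 \<le> t \<Longrightarrow> b \<le> p (z + t *\<^sub>R x) - t * a"
  shows "b \<le> push_down p x a z"
  unfolding push_down_def by (rule cINF_greatest) (use assms in auto)

lemma push_down_le_self:
  assumes "sublinear p" "a \<le> p x"
  shows "push_down p x a z \<le> p z"
  using push_down_le[OF assms, of 0 z] by simp

lemma push_down_minus:
  assumes "sublinear p" "a \<le> p x"
  shows "push_down p x a (- x) \<le> - a"
  using push_down_le[OF assms, of 1 "- x"] sublinear_zero[OF assms(1)] by simp

lemma sublinear_push_down:
  assumes p: "sublinear p" and a: "a \<le> p x"
  shows "sublinear (push_down p x a)"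
  unfolding sublinear_def
proof (intro conjI allI impI)
  fix y z
  let ?q = "push_down p x a"
  have "?q (y + z) - (p (z + s *\<^sub>R x) - s * a) \<le> ?q y" if s: "0 \<le> s" for s
  proof (rule push_down_greatest)
    fix t :: real assume t: "0 \<le> t"
    have "?q (y + z) \<le> p ((y + z) + (t + s) *\<^sub>R x) - (t + s) * a"
      using push_down_le[OF p a] s t by simp
    also have "(y + z) + (t + s) *\<^sub>R x = (y + t *\<^sub>R x) + (z + s *\<^sub>R x)"
      by (simp add: algebra_simps)
    finally show "?q (y + z) - (p (z + s *\<^sub>R x) - s * a) \<le> p (y + t *\<^sub>R x) - t * a"
      using sublinear_add[OF p, of "y + t *\<^sub>R x" "z + s *\<^sub>R x"]
      by (simp add: algebra_simps)
  qed
  then have "?q (y + z) - ?q y \<le> ?q z"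
    by (intro push_down_greatest) (simp add: algebra_simps)
  then show "?q (y + z) \<le> ?q y + ?q z" by simp
next
  fix c :: real and z assume c: "0 < c"
  let ?q = "push_down p x a"
  have le: "?q (c *\<^sub>R z) \<le> c * ?q z" if c: "0 < c" for c z
  proof -
    have "?q (c *\<^sub>R z) / c \<le> ?q z"
    proof (rule push_down_greatest)
      fix t :: real assume t: "0 \<le> t"
      have "?q (c *\<^sub>R z) \<le> p (c *\<^sub>R z + (c * t) *\<^sub>R x) - c * t * a"
        using push_down_le[OF p a] c t by simp
      also have "c *\<^sub>R z + (c * t) *\<^sub>R x = c *\<^sub>R (z + t *\<^sub>R x)"
        by (simp add: algebra_simps)
      finally show "?q (c *\<^sub>R z) / c \<le> p (z + t *\<^sub>R x) - t * a"
        using c sublinear_scale[OF p c, of "z + t *\<^sub>R x"] by (simp add: field_simps)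
    qed
    then show ?thesis using c by (simp add: field_simps)
  qed
  have "c * ?q z \<le> ?q (c *\<^sub>R z)"
    using le[of "1 / c" "c *\<^sub>R z"] c by (simp add: field_simps)
  then show "?q (c *\<^sub>R z) = c * ?q z" using le[OF c, of z] by simp
qed

text \<open>
  A minimal \<open>q\<close> is not changed by \<open>push_down q x (q x)\<close>, hence \<open>q (- x) \<le> - q x\<close>; being odd,
  it turns subadditivity into additivity.
\<close>

lemma minimal_sublinear_linear:
  assumes q: "sublinear q" and min: "\<And>r. sublinear r \<Longrightarrow> (\<And>x. r x \<le> q x) \<Longrightarrow> r = q"
  shows "linear q"
proof -
  have odd: "q (- x) = - q x" for x
  proof -
    have "push_down q x (q x) = q"
      using sublinear_push_down[OF q] push_down_le_self[OF q] by (intro min) auto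
    then show ?thesis
      using push_down_minus[OF q, of "q x" x] sublinear_ge_neg[OF q, of x] by simp
  qed
  show ?thesis
  proof (rule linearI)
    fix x y
    show "q (x + y) = q x + q y"
      using sublinear_add[OF q, of x y] sublinear_add[OF q, of "- x" "- y"]
        odd[of x] odd[of y] odd[of "x + y"] by simp
  next
    fix c x
    show "q (c *\<^sub>R x) = c *\<^sub>R q x"
    proof (cases "c < 0")
      case True
      then show ?thesis
        using sublinear_scale[OF q, of "- c" x] odd[of "c *\<^sub>R x"] by simp
    next
      case False
      then show ?thesis
        using sublinear_scale[OF q, of c x] sublinear_zero[OF q] by (cases "c = 0") auto
    qed
  qed
qed

lemma sublinear_INF_chain:
  assumes C: "C \<noteq> {}" "\<And>r. r \<in> C \<Longrightarrow> sublinear r" "\<And>r x. r \<in> C \<Longrightarrow> r x \<le> p x"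
    and chain: "\<And>r s. r \<in> C \<Longrightarrow> s \<in> C \<Longrightarrow> r \<le> s \<or> s \<le> r"
  defines "u \<equiv> \<lambda>x. INF r\<in>C. r x"
  shows "sublinear u" and "\<And>r x. r \<in> C \<Longrightarrow> u x \<le> r x"
proof -
  have bdd: "bdd_below ((\<lambda>r. r x) ` C)" for x
  proof (rule bdd_belowI2)
    fix r assume r: "r \<in> C"
    show "- p (- x) \<le> r x"
      using sublinear_ge_neg[OF C(2)[OF r], of x] C(3)[OF r, of "- x"] by simp
  qed
  show le: "u x \<le> r x" if "r \<in> C" for r x
    unfolding u_def using that by (intro cINF_lower bdd)
  have greatest: "b \<le> u x" if "\<And>r. r \<in> C \<Longrightarrow> b \<le> r x" for b x
    unfolding u_def using that C(1) by (intro cINF_greatest) auto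
  show "sublinear u"
    unfolding sublinear_def
  proof (intro conjI allI impI)
    fix x y
    have "u (x + y) - s y \<le> u x" if s: "s \<in> C" for s
    proof (rule greatest)
      fix r assume r: "r \<in> C"
      \<comment> \<open>the smaller of the two functionals serves both arguments\<close>
      obtain m where m: "m \<in> C" "m \<le> r" "m \<le> s"
        using chain[OF r s] r s by blast
      have "u (x + y) \<le> m x + m y"
        using le[OF m(1), of "x + y"] sublinear_add[OF C(2)[OF m(1)], of x y] by simp
      also have "\<dots> \<le> r x + s y"
        using m by (intro add_mono) (auto simp: le_fun_def)
      finally show "u (x + y) - s y \<le> r x" by simp
    qed
    then have "u (x + y) - u x \<le> u y"
      by (intro greatest) (simp add: algebra_simps)
    then show "u (x + y) \<le> u x + u y" by simp
  next
    fix c :: real and x assume c: "0 < c"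
    have "u (c *\<^sub>R x) / c \<le> u x"
    proof (rule greatest)
      fix r assume r: "r \<in> C"
      show "u (c *\<^sub>R x) / c \<le> r x"
        using le[OF r, of "c *\<^sub>R x"] sublinear_scale[OF C(2)[OF r] c, of x] c
        by (simp add: field_simps)
    qed
    moreover have "c * u x \<le> u (c *\<^sub>R x)"
    proof (rule greatest)
      fix r assume r: "r \<in> C"
      show "c * u x \<le> r (c *\<^sub>R x)"
        using le[OF r, of x] sublinear_scale[OF C(2)[OF r] c, of x] c by simp
    qed
    ultimately show "u (c *\<^sub>R x) = c * u x" using c by (simp add: field_simps)
  qed
qed

text \<open>
  Zorn's lemma, with the pointwise infimum as the lower bound of a chain, gives a minimal sublinear
  functional below \<open>p\<close>.
\<close>

lemma hahn_banach_sublinear: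
  fixes p :: "'a::real_vector \<Rightarrow> real"
  assumes p: "sublinear p"
  obtains \<phi> where "linear \<phi>" "\<And>x. \<phi> x \<le> p x"
proof -
  define A where "A = {r. sublinear r \<and> r \<le> p}"
  have "\<exists>m\<in>A. \<forall>a\<in>A. m \<ge> a \<longrightarrow> a = m"
  proof (rule predicate_Zorn)
    show "partial_order_on A (relation_of (\<lambda>r s. r \<ge> s) A)"
      by (rule partial_order_on_relation_ofI) auto
    fix C assume C: "C \<in> Chains (relation_of (\<lambda>r s. r \<ge> s) A)"
    then have CA: "C \<subseteq> A" and chain: "\<And>r s. r \<in> C \<Longrightarrow> s \<in> C \<Longrightarrow> r \<le> s \<or> s \<le> r"
      by (auto simp: Chains_def relation_of_def)
    show "\<exists>u\<in>A. \<forall>a\<in>C. u \<le> a"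
    proof (cases "C = {}")
      case True
      then show ?thesis using p by (auto simp: A_def)
    next
      case False
      let ?u = "\<lambda>x. INF r\<in>C. r x"
      have u: "sublinear ?u" "\<And>r x. r \<in> C \<Longrightarrow> ?u x \<le> r x"
        using sublinear_INF_chain[OF False, of p] CA chain by (auto simp: A_def le_fun_def)
      obtain r where "r \<in> C" using False by blast
      then have "?u \<le> p"
        using u(2) CA by (force simp: A_def le_fun_def intro: order_trans)
      then show ?thesis using u by (intro bexI[of _ ?u]) (auto simp: A_def le_fun_def)
    qed
  qed
  then obtain m where m: "sublinear m" "m \<le> p" "\<And>r. r \<in> A \<Longrightarrow> r \<le> m \<Longrightarrow> r = m"
    by (auto simp: A_def)
  have "linear m"
  proof (rule minimal_sublinear_linear[OF m(1)])
    fix r assume r: "sublinear r" "\<And>x. r x \<le> m x"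
    then have "r \<le> m" by (simp add: le_fun_def)
    then show "r = m" using m(2,3) r(1) by (auto simp: A_def)
  qed
  with m show thesis by (intro that) (auto simp: le_fun_def)
qed

section \<open>Support functionals and difference quotients of the norm\<close>

lemma sublinear_norm: "sublinear (norm :: 'a::real_normed_vector \<Rightarrow> real)"
  by (simp add: sublinear_def norm_triangle_ineq)

text \<open>
  Pushing the norm down twice, first to \<open>- 1\<close> at \<open>- k\<close> and then to \<open>- a\<close> at \<open>- x\<close>, leaves
  only functionals of norm 1 that support \<open>k\<close> and are at least \<open>a\<close> at \<open>x\<close>.  The hypothesis is
  what the second step needs, rewritten with \<open>s = 1 / t\<close>: the first push-down at \<open>x\<close> is the
  infimum of \<open>norm (x + s k) - s\<close>.
\<close>

lemma support_functional_ge: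
  fixes k x :: "'a::real_normed_vector"
  assumes k: "norm k = 1" and a: "\<And>t. 0 < t \<Longrightarrow> 1 + t * a \<le> norm (k + t *\<^sub>R x)"
  obtains \<phi> where "\<phi> \<in> J k" "a \<le> blinfun_apply \<phi> x"
proof -
  let ?p = "push_down norm k 1"
  have p: "sublinear ?p"
    using sublinear_push_down[OF sublinear_norm, of 1 k] k by simp
  have ax: "a \<le> ?p x"
  proof (rule push_down_greatest)
    fix s :: real assume s: "0 \<le> s"
    show "a \<le> norm (x + s *\<^sub>R k) - s * 1"
    proof (cases "s = 0")
      case True
      then show ?thesis
        using a[of 1] norm_triangle_ineq[of k x] k by simp
    next
      case False
      then have s0: "0 < s" using s by simp
      have "s * norm (k + (1/s) *\<^sub>R x) = norm (s *\<^sub>R (k + (1/s) *\<^sub>R x))"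
        using s0 by simp
      also have "s *\<^sub>R (k + (1/s) *\<^sub>R x) = x + s *\<^sub>R k"
        using s0 by (simp add: algebra_simps)
      finally show ?thesis
        using mult_left_mono[OF a[of "1/s"], of s] s0 by (simp add: algebra_simps)
    qed
  qed
  obtain \<psi> where psi: "linear \<psi>" "\<And>z. \<psi> z \<le> push_down ?p x a z"
    using hahn_banach_sublinear[OF sublinear_push_down[OF p ax]] by blast
  have le_p: "\<psi> z \<le> ?p z" for z
    using psi(2) push_down_le_self[OF p ax] order_trans by blast
  have le_norm: "\<psi> z \<le> norm z" for z
    using le_p[of z] push_down_le_self[OF sublinear_norm, of 1 k z] k by simp
  have neg: "\<psi> (- z) = - \<psi> z" for z
    using linear_neg[OF psi(1)] .
  have abs_le: "\<bar>\<psi> z\<bar> \<le> norm z" for z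
    using le_norm[of z] le_norm[of "- z"] neg[of z] by simp
  have "bounded_linear \<psi>"
    using psi(1) abs_le
    by (intro bounded_linear_intro[where K = 1]) (auto simp: linear_add linear_scale)
  then have app: "blinfun_apply (Blinfun \<psi>) = \<psi>"
    by (rule bounded_linear_Blinfun_apply)
  have "- \<psi> k \<le> - 1"
    using le_p[of "- k"] push_down_minus[OF sublinear_norm, of 1 k] k neg[of k] by simp
  then have one: "\<psi> k = 1" using le_norm[of k] k by simp
  have "norm (Blinfun \<psi>) \<le> 1"
    using abs_le by (intro norm_blinfun_bound) (auto simp: app)
  moreover have "1 \<le> norm (Blinfun \<psi>)"
    using norm_blinfun[of "Blinfun \<psi>" k] k one by (simp add: app)
  ultimately have "Blinfun \<psi> \<in> J k"
    using one by (simp add: support_functionals_def app)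
  moreover have "a \<le> \<psi> x"
    using psi(2)[of "- x"] push_down_minus[OF p ax] neg[of x] by simp
  ultimately show thesis using that app by auto
qed

lemma J_bounds:
  assumes "\<phi> \<in> J k"
  shows "blinfun_apply \<phi> k = 1" and "\<bar>blinfun_apply \<phi> x\<bar> \<le> norm x"
  using assms norm_blinfun[of \<phi> x] by (auto simp: support_functionals_def)

lemma J_nonempty:
  assumes "norm k = 1" shows "\<exists>\<phi>. \<phi> \<in> J k"
  using support_functional_ge[OF assms, of 0 0] assms by auto

lemma abs_le_v_seminorm:
  assumes "\<phi> \<in> J k" shows "\<bar>blinfun_apply \<phi> x\<bar> \<le> v_seminorm k x"
  unfolding v_seminorm_def
  by (rule cSUP_upper) (use assms J_bounds(2) in \<open>auto intro!: bdd_aboveI2\<close>)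

lemma v_seminorm_least:
  assumes "norm k = 1" "\<And>\<phi>. \<phi> \<in> J k \<Longrightarrow> \<bar>blinfun_apply \<phi> x\<bar> \<le> b"
  shows "v_seminorm k x \<le> b"
  unfolding v_seminorm_def by (rule cSUP_least) (use assms J_nonempty in auto)

lemma v_seminorm_nonneg:
  assumes "norm k = 1" shows "0 \<le> v_seminorm k x"
  using J_nonempty[OF assms] abs_le_v_seminorm[of _ k x] abs_ge_zero order_trans by blast

lemma v_seminorm_le_norm:
  assumes "norm k = 1" shows "v_seminorm k x \<le> norm x"
  using v_seminorm_least[OF assms] J_bounds(2) by blast

lemma v_seminorm_triangle:
  assumes "norm k = 1" shows "v_seminorm k (x + y) \<le> v_seminorm k x + v_seminorm k y"
proof (rule v_seminorm_least[OF assms])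
  fix \<phi> assume "\<phi> \<in> J k"
  then show "\<bar>blinfun_apply \<phi> (x + y)\<bar> \<le> v_seminorm k x + v_seminorm k y"
    using abs_le_v_seminorm[of \<phi> k x] abs_le_v_seminorm[of \<phi> k y]
    by (simp add: blinfun.add_right)
qed

lemma v_seminorm_scale:
  assumes "norm k = 1" shows "v_seminorm k (c *\<^sub>R x) = \<bar>c\<bar> * v_seminorm k x"
proof -
  have le: "v_seminorm k (c *\<^sub>R x) \<le> \<bar>c\<bar> * v_seminorm k x" for c x
    using abs_le_v_seminorm[of _ k x]
    by (intro v_seminorm_least[OF assms]) (simp add: blinfun.scaleR_right abs_mult mult_left_mono)
  show ?thesis
  proof (cases "c = 0")
    case True
    then show ?thesis using le[of 0 x] v_seminorm_nonneg[OF assms, of 0] by simp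
  next
    case False
    then show ?thesis
      using le[of c x] le[of "1 / c" "c *\<^sub>R x"] by (simp add: field_simps)
  qed
qed

lemma v_seminorm_minus:
  assumes "norm k = 1" shows "v_seminorm k (- x) = v_seminorm k x"
  using v_seminorm_scale[OF assms, of "-1" x] by simp

lemma v_seminorm_combination:
  assumes k: "norm k = 1" and "0 \<le> a" "0 \<le> b"
  shows "v_seminorm k (a *\<^sub>R x + b *\<^sub>R y) \<le> a * v_seminorm k x + b * v_seminorm k y"
  using v_seminorm_triangle[OF k, of "a *\<^sub>R x" "b *\<^sub>R y"] assms(2,3)
  by (simp add: v_seminorm_scale[OF k])

lemma v_seminorm_line_continuous:
  assumes k: "norm k = 1"
  shows "continuous_on UNIV (\<lambda>c. v_seminorm k (x + c *\<^sub>R y))"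
proof -
  have lip: "v_seminorm k a \<le> v_seminorm k b + dist a b" for a b
    using v_seminorm_triangle[OF k, of b "a - b"] v_seminorm_le_norm[OF k, of "a - b"]
    by (simp add: dist_norm)
  have "dist (v_seminorm k a) (v_seminorm k b) \<le> dist a b" for a b
    using lip[of a b] lip[of b a] by (simp add: dist_real_def dist_commute)
  then have "continuous_on UNIV (v_seminorm k)"
    by (auto simp: continuous_on_iff intro: order_le_less_trans)
  then show ?thesis
    by (rule continuous_on_compose2) (auto intro!: continuous_intros)
qed

text \<open>
  The supremum of \<open>\<phi> x\<close> over \<open>J k\<close>, and likewise that of \<open>- \<phi> x\<close>, is a lower bound
  for the difference quotients at \<open>k\<close>, hence attained by \<open>support_functional_ge\<close>.  This replaces
  the weak-star compactness of \<open>J k\<close>.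
\<close>

lemma v_seminorm_attained:
  assumes k: "norm k = 1"
  obtains \<phi> where "\<phi> \<in> J k" "\<bar>blinfun_apply \<phi> x\<bar> = v_seminorm k x"
proof -
  have bound: "norm (k + t *\<^sub>R (\<sigma> *\<^sub>R x)) \<ge> 1 + t * (\<sigma> * blinfun_apply \<phi> x)"
    if "\<phi> \<in> J k" for \<phi> t \<sigma>
    using J_bounds(1)[OF that] J_bounds(2)[OF that, of "k + t *\<^sub>R (\<sigma> *\<^sub>R x)"]
    by (simp add: blinfun.add_right blinfun.scaleR_right)
  define s where "s \<sigma> = (SUP \<phi>\<in>J k. blinfun_apply \<phi> (\<sigma> *\<^sub>R x))" for \<sigma> :: real
  have ne: "J k \<noteq> {}" using J_nonempty[OF k] by auto
  have bdd: "bdd_above ((\<lambda>\<phi>. blinfun_apply \<phi> y) ` J k)" for y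
    using J_bounds(2)[of _ k y] by (intro bdd_aboveI2[of _ _ "norm y"]) (simp add: abs_le_iff)
  have "\<exists>\<phi>\<in>J k. \<forall>\<psi>\<in>J k. \<sigma> * blinfun_apply \<psi> x \<le> \<sigma> * blinfun_apply \<phi> x" for \<sigma>
  proof -
    have "1 + t * s \<sigma> \<le> norm (k + t *\<^sub>R (\<sigma> *\<^sub>R x))" if t: "0 < t" for t
    proof -
      have "s \<sigma> \<le> (norm (k + t *\<^sub>R (\<sigma> *\<^sub>R x)) - 1) / t"
        unfolding s_def using bound[of _ t \<sigma>] t
        by (intro cSUP_least ne) (simp add: field_simps blinfun.scaleR_right)
      then show ?thesis using t by (simp add: field_simps)
    qed
    then obtain \<phi> where phi: "\<phi> \<in> J k" "s \<sigma> \<le> blinfun_apply \<phi> (\<sigma> *\<^sub>R x)"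
      using support_functional_ge[OF k] by blast
    have "blinfun_apply \<psi> (\<sigma> *\<^sub>R x) \<le> s \<sigma>" if "\<psi> \<in> J k" for \<psi>
      unfolding s_def using that by (intro cSUP_upper bdd)
    then have "\<sigma> * blinfun_apply \<psi> x \<le> \<sigma> * blinfun_apply \<phi> x" if "\<psi> \<in> J k" for \<psi>
      using order_trans[OF _ phi(2)] that by (simp add: blinfun.scaleR_right)
    then show ?thesis using phi(1) by blast
  qed
  from this[of 1] this[of "-1"] obtain \<phi> \<phi>' where
    phi: "\<phi> \<in> J k" "\<And>\<psi>. \<psi> \<in> J k \<Longrightarrow> blinfun_apply \<psi> x \<le> blinfun_apply \<phi> x" and
    phi': "\<phi>' \<in> J k" "\<And>\<psi>. \<psi> \<in> J k \<Longrightarrow> blinfun_apply \<phi>' x \<le> blinfun_apply \<psi> x"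
    by auto
  define \<theta> where "\<theta> = (if \<bar>blinfun_apply \<phi>' x\<bar> \<le> \<bar>blinfun_apply \<phi> x\<bar> then \<phi> else \<phi>')"
  have theta: "\<theta> \<in> J k" using phi(1) phi'(1) by (simp add: \<theta>_def)
  have "\<bar>blinfun_apply \<psi> x\<bar> \<le> \<bar>blinfun_apply \<theta> x\<bar>" if "\<psi> \<in> J k" for \<psi>
    using phi(2)[OF that] phi'(2)[OF that] by (auto simp: \<theta>_def)
  then have "v_seminorm k x \<le> \<bar>blinfun_apply \<theta> x\<bar>"
    by (rule v_seminorm_least[OF k])
  then show thesis
    using that theta abs_le_v_seminorm[OF theta, of x] by force
qed

text \<open>
  The larger of the difference quotients of the norm at a unit vector \<open>k\<close> in the directions \<open>x\<close>
  and \<open>- x\<close>; the value 1 stands for \<open>norm k\<close>.  As \<open>t\<close> decreases to 0 it decreases to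
  \<open>v_seminorm k x\<close>, while for fixed \<open>t\<close> it is continuous in both \<open>k\<close> and \<open>x\<close>.
\<close>

definition norm_slope :: "'a::real_normed_vector \<Rightarrow> 'a \<Rightarrow> real \<Rightarrow> real"
  where "norm_slope k x t = (max (norm (k + t *\<^sub>R x)) (norm (k - t *\<^sub>R x)) - 1) / t"

lemma v_seminorm_le_norm_slope:
  assumes k: "norm k = 1" and t: "0 < t"
  shows "v_seminorm k x \<le> norm_slope k x t"
proof (rule v_seminorm_least[OF k])
  fix \<phi> assume phi: "\<phi> \<in> J k"
  have "1 + t * blinfun_apply \<phi> x \<le> norm (k + t *\<^sub>R x)"
    using J_bounds(1)[OF phi] J_bounds(2)[OF phi, of "k + t *\<^sub>R x"]
    by (simp add: blinfun.add_right blinfun.scaleR_right)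
  moreover have "1 - t * blinfun_apply \<phi> x \<le> norm (k - t *\<^sub>R x)"
    using J_bounds(1)[OF phi] J_bounds(2)[OF phi, of "k - t *\<^sub>R x"]
    by (simp add: blinfun.diff_right blinfun.scaleR_right)
  ultimately have "1 + t * \<bar>blinfun_apply \<phi> x\<bar> \<le> max (norm (k + t *\<^sub>R x)) (norm (k - t *\<^sub>R x))"
    by (cases "0 \<le> blinfun_apply \<phi> x") (simp_all add: le_max_iff_disj)
  then show "\<bar>blinfun_apply \<phi> x\<bar> \<le> norm_slope k x t"
    using t by (simp add: norm_slope_def field_simps)
qed

lemma norm_line_slope_mono:
  fixes k x :: "'a::real_normed_vector"
  assumes k: "norm k = 1" and t: "0 < t" "t \<le> s"
  shows "(norm (k + t *\<^sub>R x) - 1) / t \<le> (norm (k + s *\<^sub>R x) - 1) / s"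
proof -
  have s: "0 < s" using t by simp
  have "k + t *\<^sub>R x = (1 - t / s) *\<^sub>R k + (t / s) *\<^sub>R (k + s *\<^sub>R x)"
    using s by (simp add: algebra_simps)
  then have "norm (k + t *\<^sub>R x) \<le> norm ((1 - t / s) *\<^sub>R k) + norm ((t / s) *\<^sub>R (k + s *\<^sub>R x))"
    by (metis norm_triangle_ineq)
  also have "\<dots> = (1 - t / s) + (t / s) * norm (k + s *\<^sub>R x)"
    using t s k by simp
  finally have "norm (k + t *\<^sub>R x) - 1 \<le> t * ((norm (k + s *\<^sub>R x) - 1) / s)"
    by (simp add: diff_divide_distrib algebra_simps)
  then show ?thesis using t by (simp add: divide_le_eq mult.commute)
qed

lemma norm_slope_alt:
  assumes "0 < t"
  shows "norm_slope k x t = max ((norm (k + t *\<^sub>R x) - 1) / t) ((norm (k + t *\<^sub>R (- x)) - 1) / t)"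
  using assms by (auto simp: norm_slope_def max_def field_simps)

lemma norm_slope_mono:
  assumes "norm k = 1" "0 < t" "t \<le> s"
  shows "norm_slope k x t \<le> norm_slope k x s"
  using norm_line_slope_mono[OF assms, of x] norm_line_slope_mono[OF assms, of "- x"] assms
  by (auto simp: norm_slope_alt max_def)

lemma norm_slope_le_norm:
  assumes "norm k = 1" "0 < t"
  shows "norm_slope k x t \<le> norm x"
  using norm_triangle_ineq[of k "t *\<^sub>R x"] norm_triangle_ineq[of k "t *\<^sub>R (- x)"] assms
  by (auto simp: norm_slope_alt field_simps)

lemma norm_slope_less:
  assumes k: "norm k = 1" and a: "v_seminorm k x < a"
  obtains t where "0 < t" "norm_slope k x t < a"
proof -
  have ex: "\<exists>t>0. (norm (k + t *\<^sub>R y) - 1) / t < a" if y: "y = x \<or> y = - x" for y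
  proof (rule ccontr)
    assume "\<not> ?thesis"
    then have le: "a \<le> (norm (k + t *\<^sub>R y) - 1) / t" if "0 < t" for t
      using that by force
    have "1 + t * a \<le> norm (k + t *\<^sub>R y)" if "0 < t" for t
      using le[OF that] that by (simp add: field_simps)
    then obtain \<phi> where "\<phi> \<in> J k" "a \<le> blinfun_apply \<phi> y"
      using support_functional_ge[OF k] by blast
    then show False
      using abs_le_v_seminorm[of \<phi> k y] y a v_seminorm_minus[OF k, of x] by auto
  qed
  obtain t where t: "0 < t" "(norm (k + t *\<^sub>R x) - 1) / t < a" using ex by blast
  obtain t' where t': "0 < t'" "(norm (k + t' *\<^sub>R (- x)) - 1) / t' < a" using ex by blast
  define m where "m = min t t'"
  have m: "0 < m" "m \<le> t" "m \<le> t'" using t(1) t'(1) by (auto simp: m_def)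
  have "norm_slope k x m < a"
    using norm_line_slope_mono[OF k m(1,2), of x] t(2)
      norm_line_slope_mono[OF k m(1,3), of "- x"] t'(2)
    by (simp only: norm_slope_alt[OF m(1)] max_less_iff_conj) simp
  then show thesis using that m(1) by blast
qed

text \<open>
  A slope below \<open>a\<close> at \<open>k\<close> stays below \<open>a\<close> at nearby points for the same \<open>t\<close>, and it bounds
  the semi-norm there.
\<close>

lemma v_seminorm_upper_semicontinuous:
  fixes K :: "'a::real_normed_vector set" and h :: "'a \<Rightarrow> 'a"
  assumes K: "K \<subseteq> sphere 0 1" and h: "continuous_on K h"
    and k: "k \<in> K" and a: "v_seminorm k (h k) < a"
  shows "\<forall>\<^sub>F l in at k within K. v_seminorm l (h l) < a"
proof -
  have unit: "norm l = 1" if "l \<in> K" for l using K that by auto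
  obtain t where t: "0 < t" "norm_slope k (h k) t < a"
    using norm_slope_less[OF unit[OF k] a] .
  have "continuous_on K (\<lambda>l. norm_slope l (h l) t)"
    using t unfolding norm_slope_def by (intro continuous_intros h) auto
  then have "\<forall>\<^sub>F l in at k within K. norm_slope l (h l) t < a"
    using k t(2) by (auto simp: continuous_on_def intro: order_tendstoD)
  moreover have "\<forall>\<^sub>F l in at k within K. l \<in> K"
    by (simp add: eventually_at_filter)
  ultimately show ?thesis
    by eventually_elim (use v_seminorm_le_norm_slope[OF unit t(1)] in \<open>auto intro: order_le_less_trans\<close>)
qed

lemma v_seminorm_superlevel_closedin:
  fixes K :: "'a::real_normed_vector set" and h :: "'a \<Rightarrow> 'a"
  assumes K: "K \<subseteq> sphere 0 1" and h: "continuous_on K h"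
  shows "closedin (top_of_set K) {k \<in> K. a \<le> v_seminorm k (h k)}"
proof -
  have "openin (top_of_set K) {k \<in> K. v_seminorm k (h k) < a}"
    unfolding openin_euclidean_subtopology_iff
  proof (intro conjI ballI)
    fix k assume "k \<in> {k \<in> K. v_seminorm k (h k) < a}"
    then have k: "k \<in> K" "v_seminorm k (h k) < a" by auto
    from v_seminorm_upper_semicontinuous[OF K h this] obtain d where
      "0 < d" "\<And>l. l \<in> K \<Longrightarrow> l \<noteq> k \<Longrightarrow> dist l k < d \<Longrightarrow> v_seminorm l (h l) < a"
      by (auto simp: eventually_at)
    then show "\<exists>e>0. \<forall>l\<in>K. dist l k < e \<longrightarrow> l \<in> {k \<in> K. v_seminorm k (h k) < a}"
      using k(2) by (intro exI[of _ d]) auto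
  qed auto
  moreover have "{k \<in> K. a \<le> v_seminorm k (h k)} = K - {k \<in> K. v_seminorm k (h k) < a}"
    by auto
  ultimately show ?thesis by (simp add: closedin_diff)
qed

section \<open>The semi-norm on functions as a maximum\<close>

lemma v_seminorm_le_w_seminorm:
  assumes K: "compact K" "K \<subseteq> sphere 0 1" and h: "continuous_on K h" and k: "k \<in> K"
  shows "v_seminorm k (h k) \<le> w_seminorm K h"
proof (rule v_seminorm_least)
  obtain B where B: "\<And>k. k \<in> K \<Longrightarrow> norm (h k) \<le> B"
    using compact_imp_bounded[OF compact_continuous_image[OF h K(1)]]
    by (auto simp: bounded_iff)
  fix \<phi> assume phi: "\<phi> \<in> J k"
  have "\<bar>blinfun_apply \<phi> (h l)\<bar> \<le> B" if "(l, \<phi>) \<in> Pi_pairs K" for l \<phi>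
    using that J_bounds(2)[of \<phi> l "h l"] B[of l] by (auto simp: Pi_pairs_def)
  then have "bdd_above ((\<lambda>(k, \<phi>). \<bar>blinfun_apply \<phi> (h k)\<bar>) ` Pi_pairs K)"
    by (intro bdd_aboveI2[of _ _ B]) auto
  then show "\<bar>blinfun_apply \<phi> (h k)\<bar> \<le> w_seminorm K h"
    unfolding w_seminorm_def using phi k
    by (intro cSUP_upper2[of _ _ "(k, \<phi>)"]) (auto simp: Pi_pairs_def)
qed (use K k in auto)

lemma w_seminorm_least:
  assumes "K \<subseteq> sphere 0 1" "K \<noteq> {}" and "\<And>k. k \<in> K \<Longrightarrow> v_seminorm k (h k) \<le> b"
  shows "w_seminorm K h \<le> b"
  unfolding w_seminorm_def
proof (rule cSUP_least)
  obtain k where k: "k \<in> K" using assms(2) by blast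
  then have "norm k = 1" using assms(1) by auto
  then obtain \<phi> where "\<phi> \<in> J k" using J_nonempty by blast
  with k show "Pi_pairs K \<noteq> {}" by (auto simp: Pi_pairs_def)
  show "(case x of (k, \<phi>) \<Rightarrow> \<bar>blinfun_apply \<phi> (h k)\<bar>) \<le> b" if "x \<in> Pi_pairs K" for x
    using that order_trans[OF abs_le_v_seminorm assms(3)] by (auto simp: Pi_pairs_def)
qed

text \<open>
  An upper semicontinuous function on a compact set attains its maximum: its superlevel sets are
  closed and nested.
\<close>

lemma w_seminorm_attained:
  assumes K: "compact K" "K \<subseteq> sphere 0 1" "K \<noteq> {}" and h: "continuous_on K h"
  obtains k where "k \<in> K" "v_seminorm k (h k) = w_seminorm K h"
proof -
  let ?W = "w_seminorm K h"
  let ?F = "\<lambda>n. {k \<in> K. ?W - 1 / Suc n \<le> v_seminorm k (h k)}"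
  have "(\<Inter>n. ?F n) \<noteq> {}"
  proof (rule compact_space_imp_nest)
    show "compact_space (top_of_set K)"
      using K(1) by (simp add: compact_space_subtopology)
    show "closedin (top_of_set K) (?F n)" for n
      using v_seminorm_superlevel_closedin[OF K(2) h] .
    show "?F n \<noteq> {}" for n
    proof
      assume "?F n = {}"
      then have "?W \<le> ?W - 1 / Suc n"
        by (intro w_seminorm_least K(2,3)) (auto simp: not_le intro: less_imp_le)
      then show False by (simp add: field_simps)
    qed
    show "decseq ?F"
      by (intro decseq_SucI) (auto elim!: order_trans[rotated] simp: frac_le)
  qed
  then obtain k where k: "k \<in> K" "\<And>n. ?W - 1 / Suc n \<le> v_seminorm k (h k)" by auto
  have "(\<lambda>n. ?W - 1 / Suc n) \<longlonglongrightarrow> ?W - 0"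
    by (intro tendsto_intros LIMSEQ_Suc[OF lim_const_over_n])
  then have "?W \<le> v_seminorm k (h k)"
    using k(2) by (intro LIMSEQ_le_const2[of _ ?W]) auto
  then show thesis
    using that k(1) v_seminorm_le_w_seminorm[OF K(1,2) h k(1)] by force
qed

section \<open>Sufficiency: half-orthogonality at a single point\<close>

text \<open>
  Right symmetry survives when orthogonality is only assumed for non-negative multiples.  A
  minimiser \<open>s\<close> of \<open>v_seminorm k (y + s x)\<close> can be taken \<open>\<le> 0\<close> by the hypothesis, and
  \<open>h = y + s x\<close> is fully orthogonal to \<open>x\<close>.  Then \<open>x + t y = (1 - t s) x + t h\<close>, where
  \<open>1 - t s \<ge> 1\<close>.
\<close>

lemma v_right_symmetric_ray:
  assumes k: "norm k = 1" and sym: "v_right_symmetric k x"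
    and ray: "\<And>s. 0 \<le> s \<Longrightarrow> v_seminorm k y \<le> v_seminorm k (y + s *\<^sub>R x)"
    and t: "0 \<le> t"
  shows "v_seminorm k x \<le> v_seminorm k (x + t *\<^sub>R y)"
proof (cases "v_seminorm k x = 0")
  case True
  then show ?thesis using v_seminorm_nonneg[OF k] by simp
next
  case False
  then have M: "0 < v_seminorm k x" using v_seminorm_nonneg[OF k, of x] by simp
  let ?\<psi> = "\<lambda>s. v_seminorm k (y + s *\<^sub>R x)"
  \<comment> \<open>left of \<open>- R\<close> the function \<open>?\<psi>\<close> is at least its value \<open>v_seminorm k y\<close> at 0\<close>
  define R where "R = 2 * v_seminorm k y / v_seminorm k x"
  have R: "0 \<le> R" using M v_seminorm_nonneg[OF k, of y] by (simp add: R_def)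
  have "\<exists>s\<in>{-R..0}. \<forall>r\<in>{-R..0}. ?\<psi> s \<le> ?\<psi> r"
    using R v_seminorm_line_continuous[OF k, of y x]
    by (intro continuous_attains_inf) (auto intro: continuous_on_subset)
  then obtain s where s: "s \<le> 0" "\<And>r. -R \<le> r \<Longrightarrow> r \<le> 0 \<Longrightarrow> ?\<psi> s \<le> ?\<psi> r" by auto
  have s0: "?\<psi> s \<le> v_seminorm k y" using s(2)[of 0] R by simp
  have min: "?\<psi> s \<le> ?\<psi> r" for r
  proof -
    consider "0 \<le> r" | "-R \<le> r" "r \<le> 0" | "r < -R" by linarith
    then show ?thesis
    proof cases
      case 1
      then show ?thesis using ray[of r] s0 by simp
    next
      case 2
      then show ?thesis using s(2) by simp
    next
      case 3
      have "v_seminorm k (r *\<^sub>R x) \<le> ?\<psi> r + v_seminorm k (- y)"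
        using v_seminorm_triangle[OF k, of "y + r *\<^sub>R x" "- y"] by simp
      then have "- r * v_seminorm k x \<le> ?\<psi> r + v_seminorm k y"
        using 3 R by (simp add: v_seminorm_scale[OF k] v_seminorm_minus[OF k])
      moreover have "R * v_seminorm k x \<le> - r * v_seminorm k x"
        using 3 M by (intro mult_right_mono) auto
      moreover have "R * v_seminorm k x = 2 * v_seminorm k y"
        using M by (simp add: R_def)
      ultimately show ?thesis using s0 by simp
    qed
  qed
  define h where "h = y + s *\<^sub>R x"
  have "v_orthogonal k h x"
    unfolding v_orthogonal_def
  proof
    fix c
    show "v_seminorm k h \<le> v_seminorm k (h + c *\<^sub>R x)"
      using min[of "s + c"] by (simp add: h_def scaleR_add_left add.assoc)
  qed
  then have orth: "v_orthogonal k x h" using sym by (simp add: v_right_symmetric_def)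
  define a where "a = 1 - t * s"
  have a: "1 \<le> a" using t s(1) by (simp add: a_def mult_nonneg_nonpos)
  have "a *\<^sub>R (x + (t / a) *\<^sub>R h) = a *\<^sub>R x + t *\<^sub>R h"
    using a by (simp add: scaleR_add_right)
  also have "\<dots> = x + t *\<^sub>R y"
    by (simp add: a_def h_def algebra_simps)
  finally have "v_seminorm k (x + t *\<^sub>R y) = a * v_seminorm k (x + (t / a) *\<^sub>R h)"
    using a v_seminorm_scale[OF k, of a "x + (t / a) *\<^sub>R h"] by simp
  moreover have "v_seminorm k x \<le> v_seminorm k (x + (t / a) *\<^sub>R h)"
    using orth by (simp add: v_orthogonal_def)
  moreover have "v_seminorm k (x + (t / a) *\<^sub>R h) \<le> a * v_seminorm k (x + (t / a) *\<^sub>R h)"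
    using a v_seminorm_nonneg[OF k] mult_right_mono[OF a] by fastforce
  ultimately show ?thesis by simp
qed

text \<open>
  For small \<open>s > 0\<close> the function \<open>g + s f\<close> has a norming point \<open>k\<close>, where
  \<open>v_seminorm k (g k + s f k) \<ge> w_seminorm K g \<ge> v_seminorm k (g k)\<close>; by convexity the first
  inequality persists for all larger multiples of \<open>f k\<close>.  So the sets of such points shrink
  with \<open>s\<close>, and a point common to all of them serves every \<open>s\<close>.
\<close>

lemma w_orthogonal_ray_point:
  fixes K :: "'a::real_normed_vector set"
  assumes K: "compact K" "K \<subseteq> sphere 0 1" "K \<noteq> {}"
    and f: "continuous_on K f" and g: "continuous_on K g" and orth: "w_orthogonal K g f"
  obtains k where "k \<in> K"
    "\<And>s. 0 \<le> s \<Longrightarrow> v_seminorm k (g k) \<le> v_seminorm k (g k + s *\<^sub>R f k)"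
proof -
  let ?W = "w_seminorm K g"
  let ?F = "\<lambda>s. {k \<in> K. ?W \<le> v_seminorm k (g k + s *\<^sub>R f k)}"
  have unit: "norm k = 1" if "k \<in> K" for k using K(2) that by auto
  have le_W: "v_seminorm k (g k) \<le> ?W" if "k \<in> K" for k
    using v_seminorm_le_w_seminorm[OF K(1,2) g that] .
  have cont: "continuous_on K (\<lambda>k. g k + s *\<^sub>R f k)" for s
    by (intro continuous_intros f g)
  have mono: "?F s \<subseteq> ?F r" if sr: "0 < s" "s \<le> r" for s r
  proof clarify
    fix k assume k: "k \<in> K" and W: "?W \<le> v_seminorm k (g k + s *\<^sub>R f k)"
    have "g k + s *\<^sub>R f k = (1 - s / r) *\<^sub>R g k + (s / r) *\<^sub>R (g k + r *\<^sub>R f k)"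
      using sr by (simp add: algebra_simps)
    then have "?W \<le> (1 - s / r) * v_seminorm k (g k) + (s / r) * v_seminorm k (g k + r *\<^sub>R f k)"
      using W sr v_seminorm_combination[OF unit[OF k], of "1 - s / r" "s / r" "g k" "g k + r *\<^sub>R f k"]
      by simp
    also have "\<dots> \<le> (1 - s / r) * ?W + (s / r) * v_seminorm k (g k + r *\<^sub>R f k)"
      using le_W[OF k] sr by (intro add_right_mono mult_left_mono) auto
    finally have "(s / r) * ?W \<le> (s / r) * v_seminorm k (g k + r *\<^sub>R f k)"
      by (simp add: algebra_simps)
    then show "?W \<le> v_seminorm k (g k + r *\<^sub>R f k)" using sr by (simp add: field_simps)
  qed
  have "(\<Inter>n. ?F (1 / Suc n)) \<noteq> {}"
  proof (rule compact_space_imp_nest)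
    show "compact_space (top_of_set K)"
      using K(1) by (simp add: compact_space_subtopology)
    show "closedin (top_of_set K) (?F (1 / Suc n))" for n
      by (rule v_seminorm_superlevel_closedin[OF K(2) cont])
    show "?F (1 / Suc n) \<noteq> {}" for n
    proof -
      obtain k where "k \<in> K"
        "v_seminorm k (g k + (1 / Suc n) *\<^sub>R f k) = w_seminorm K (\<lambda>k. g k + (1 / Suc n) *\<^sub>R f k)"
        using w_seminorm_attained[OF K cont] .
      moreover have "?W \<le> w_seminorm K (\<lambda>k. g k + (1 / Suc n) *\<^sub>R f k)"
        using orth by (simp add: w_orthogonal_def)
      ultimately show ?thesis by auto
    qed
    show "decseq (\<lambda>n. ?F (1 / Suc n))"
      by (intro decseq_SucI mono) (simp_all add: frac_le)
  qed
  then obtain k where k: "k \<in> K" "\<And>n. k \<in> ?F (1 / Suc n)" by auto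
  show thesis
  proof (rule that[OF k(1)])
    fix s :: real assume "0 \<le> s"
    show "v_seminorm k (g k) \<le> v_seminorm k (g k + s *\<^sub>R f k)"
    proof (cases "s = 0")
      case False
      then obtain n where "1 / Suc n < s"
        using nat_approx_posE[of s] \<open>0 \<le> s\<close> by (auto simp: inverse_eq_divide)
      then have "k \<in> ?F s" using mono[of "1 / Suc n" s] k(2)[of n] by auto
      then show ?thesis using le_W[OF k(1)] by simp
    qed simp
  qed
qed

text \<open>
  The half-line \<open>t \<ge> 0\<close> comes from the common point above, and \<open>t \<le> 0\<close> from the same argument for
  \<open>- g\<close>; the two points may differ.
\<close>

lemma nr_right_symmetric_if_pointwise:
  fixes K :: "'a::real_normed_vector set"
  assumes K: "compact K" "K \<subseteq> sphere 0 1" "K \<noteq> {}" and f: "continuous_on K f"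
    and norming: "\<And>k. k \<in> K \<Longrightarrow> v_seminorm k (f k) = w_seminorm K f"
    and sym: "\<And>k. k \<in> K \<Longrightarrow> v_right_symmetric k (f k)"
  shows "nr_right_symmetric K f"
proof -
  have ray: "w_seminorm K f \<le> w_seminorm K (\<lambda>k. f k + t *\<^sub>R g k)"
    if g: "continuous_on K g" and orth: "w_orthogonal K g f" and t: "0 \<le> t" for g t
  proof -
    obtain k where k: "k \<in> K"
      "\<And>s. 0 \<le> s \<Longrightarrow> v_seminorm k (g k) \<le> v_seminorm k (g k + s *\<^sub>R f k)"
      using w_orthogonal_ray_point[OF K f g orth] by blast
    have unit: "norm k = 1" using K(2) k(1) by auto
    have "w_seminorm K f \<le> v_seminorm k (f k + t *\<^sub>R g k)"
      using v_right_symmetric_ray[OF unit sym[OF k(1)] k(2) t] norming[OF k(1)] by simp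
    also have "\<dots> \<le> w_seminorm K (\<lambda>k. f k + t *\<^sub>R g k)"
      by (intro v_seminorm_le_w_seminorm K k(1) continuous_intros f g)
    finally show ?thesis .
  qed
  have w_minus: "w_seminorm K (\<lambda>k. - h k) = w_seminorm K h" for h
    unfolding w_seminorm_def by (simp add: blinfun.minus_right)
  show ?thesis
    unfolding nr_right_symmetric_def
  proof (intro allI impI)
    fix g assume g: "continuous_on K g" and orth: "w_orthogonal K g f"
    have "w_orthogonal K (\<lambda>k. - g k) f"
      unfolding w_orthogonal_def
    proof
      fix c
      have "w_seminorm K g \<le> w_seminorm K (\<lambda>k. g k + (- c) *\<^sub>R f k)"
        using orth unfolding w_orthogonal_def by blast
      also have "\<dots> = w_seminorm K (\<lambda>k. - (g k + (- c) *\<^sub>R f k))"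
        by (rule w_minus[symmetric])
      also have "(\<lambda>k. - (g k + (- c) *\<^sub>R f k)) = (\<lambda>k. - g k + c *\<^sub>R f k)"
        by simp
      finally show "w_seminorm K (\<lambda>k. - g k) \<le> w_seminorm K (\<lambda>k. - g k + c *\<^sub>R f k)"
        by (simp only: w_minus)
    qed
    then have neg: "w_seminorm K f \<le> w_seminorm K (\<lambda>k. f k + t *\<^sub>R (- g k))" if "0 \<le> t" for t
      using ray[OF continuous_on_minus[OF g]] that by blast
    show "w_orthogonal K f g"
      unfolding w_orthogonal_def
    proof
      fix c :: real
      show "w_seminorm K f \<le> w_seminorm K (\<lambda>k. f k + c *\<^sub>R g k)"
      proof (cases "0 \<le> c")
        case True
        then show ?thesis by (rule ray[OF g orth])
      next
        case False
        then show ?thesis using neg[of "- c"] by simp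
      qed
    qed
  qed
qed

section \<open>Necessity: perturbing a function near one point\<close>

text \<open>
  Upper semicontinuity alone lets \<open>v_seminorm k y\<close> exceed 1 at points near \<open>k0\<close>; the factor
  \<open>\<alpha>\<close> compensates for this and still equals 1 at \<open>k0\<close>.  It is the reciprocal of a continuous upper
  bound of \<open>v_seminorm k y\<close>, namely the slope at \<open>k\<close> with a step \<open>t\<close> that tends to 0 as
  \<open>k\<close> tends to \<open>k0\<close>.  Replacing \<open>k\<close> by \<open>k0\<close> changes the slope by at most
  \<open>dist k k0 / t\<close>, so the step has to tend to 0 more slowly than the distance; its square root
  makes the error equal to the step.
\<close>

lemma continuous_damping:
  fixes K :: "'a::real_normed_vector set"
  assumes K: "K \<subseteq> sphere 0 1" and k0: "k0 \<in> K" and y: "v_seminorm k0 y \<le> 1"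
  obtains \<alpha> where "continuous_on K \<alpha>" "\<alpha> k0 = 1"
    "\<And>k. k \<in> K \<Longrightarrow> 1 / max 1 (norm y) \<le> \<alpha> k" "\<And>k. k \<in> K \<Longrightarrow> \<alpha> k \<le> 1"
    "\<And>k. k \<in> K \<Longrightarrow> \<alpha> k * v_seminorm k y \<le> 1"
proof -
  define \<tau> where "\<tau> k = sqrt (dist k k0)" for k
  define P where "P k = (if k = k0 then 1 else max 1 (norm_slope k y (\<tau> k)))" for k
  have unit: "norm k = 1" if "k \<in> K" for k using K that by auto
  have pos: "0 < \<tau> k" if "k \<noteq> k0" for k using that by (simp add: \<tau>_def)
  have P1: "1 \<le> P k" for k by (simp add: P_def)
  have P_pos: "P k \<noteq> 0" for k using P1[of k] by linarith
  have P_le: "P k \<le> max 1 (norm y)" if "k \<in> K" for k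
    using norm_slope_le_norm[OF unit[OF that] pos, of k y] by (auto simp: P_def max_def)
  have v_le: "v_seminorm k y \<le> P k" if "k \<in> K" for k
    using v_seminorm_le_norm_slope[OF unit[OF that] pos, of k y] y by (auto simp: P_def)
  have near: "norm_slope k y (\<tau> k) \<le> norm_slope k0 y (\<tau> k) + \<tau> k" if "k \<noteq> k0" for k
  proof -
    have "max (norm (k + \<tau> k *\<^sub>R y)) (norm (k - \<tau> k *\<^sub>R y))
        \<le> max (norm (k0 + \<tau> k *\<^sub>R y)) (norm (k0 - \<tau> k *\<^sub>R y)) + dist k k0"
      using norm_triangle_ineq[of "k0 + \<tau> k *\<^sub>R y" "k - k0"]
        norm_triangle_ineq[of "k0 - \<tau> k *\<^sub>R y" "k - k0"]
      by (simp add: dist_norm max_def algebra_simps)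
    moreover have "dist k k0 = \<tau> k * \<tau> k" by (simp add: \<tau>_def)
    ultimately show ?thesis
      using pos[OF that] by (simp add: norm_slope_def field_simps)
  qed
  have "continuous_on K P"
    unfolding continuous_on_def
  proof
    fix k assume k: "k \<in> K"
    show "(P \<longlongrightarrow> P k) (at k within K)"
    proof (cases "k = k0")
      case True
      have "(P \<longlongrightarrow> 1) (at k0 within K)"
      proof (rule order_tendstoI)
        fix a :: real assume "a < 1"
        then show "\<forall>\<^sub>F k in at k0 within K. a < P k"
          using P1 by (auto intro!: always_eventually intro: less_le_trans)
      next
        fix a :: real assume a: "1 < a"
        define e where "e = (a - 1) / 2"
        have e: "0 < e" "a = 1 + e + e" using a by (auto simp: e_def)
        obtain t where t: "0 < t" "norm_slope k0 y t < 1 + e"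
          using norm_slope_less[OF unit[OF k0], of y "1 + e"] y e by auto
        have "(\<tau> \<longlongrightarrow> \<tau> k0) (at k0 within K)"
          unfolding \<tau>_def by (intro tendsto_intros)
        then have "(\<tau> \<longlongrightarrow> 0) (at k0 within K)" by (simp add: \<tau>_def)
        then have "\<forall>\<^sub>F k in at k0 within K. \<tau> k < min t e"
          using t(1) e(1) by (intro order_tendstoD) auto
        moreover have "\<forall>\<^sub>F k in at k0 within K. k \<noteq> k0"
          by (simp add: eventually_at_filter)
        ultimately show "\<forall>\<^sub>F k in at k0 within K. P k < a"
        proof eventually_elim
          case (elim k)
          have "norm_slope k y (\<tau> k) \<le> norm_slope k0 y t + \<tau> k"
            using near[OF elim(2)] norm_slope_mono[OF unit[OF k0] pos[OF elim(2)], of t y] elim(1)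
            by simp
          also have "\<dots> < a" using t(2) elim(1) e(2) by simp
          finally show ?case using a by (simp add: P_def)
        qed
      qed
      then show ?thesis using True by (simp add: P_def)
    next
      case False
      have "((\<lambda>l. max 1 (norm_slope l y (\<tau> l))) \<longlongrightarrow> max 1 (norm_slope k y (\<tau> k))) (at k within K)"
        unfolding norm_slope_def \<tau>_def using False by (intro tendsto_intros) auto
      moreover have "\<forall>\<^sub>F l in at k within K. max 1 (norm_slope l y (\<tau> l)) = P l"
        using eventually_neq_at_within[of k0 k K]
        by eventually_elim (simp add: P_def)
      ultimately show ?thesis
        using False tendsto_cong[of "\<lambda>l. max 1 (norm_slope l y (\<tau> l))" P "at k within K"]
        by (simp add: P_def[of k])
    qed
  qed
  show thesis
  proof
    show "continuous_on K (\<lambda>k. 1 / P k)"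
      using \<open>continuous_on K P\<close> P_pos by (intro continuous_intros) auto
    show "1 / P k0 = 1" by (simp add: P_def)
    show "1 / max 1 (norm y) \<le> 1 / P k" if "k \<in> K" for k
      using P_le[OF that] P1[of k] by (intro divide_left_mono) auto
    show "1 / P k \<le> 1" for k using P1[of k] by simp
    show "1 / P k * v_seminorm k y \<le> 1" if "k \<in> K" for k
      using v_le[OF that] P1[of k] by (simp add: divide_le_eq)
  qed
qed

text \<open>
  With \<open>M = w_seminorm K f\<close>, a ramp \<open>\<rho>\<close> supported near \<open>k0\<close> and the damping factor
  \<open>\<alpha>\<close>, the function is \<open>g = \<rho> \<alpha> y - (1 - \<rho>) f / M\<close>.  For small \<open>t\<close> the vector
  \<open>f k + t g k\<close> is a combination of \<open>f k\<close> and \<open>f k + c y\<close> with non-negative coefficients.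
  Near \<open>k0\<close> it loses length because \<open>f k + c y\<close> is shorter than \<open>M\<close>, and elsewhere because
  \<open>g\<close> points back along \<open>f\<close>; where \<open>\<rho>\<close> is between 0 and 1 the two losses add up, and since
  \<open>\<alpha>\<close> is bounded away from 0 the total loss is so too.
\<close>

lemma descent_direction:
  fixes K :: "'a::real_normed_vector set"
  assumes K: "compact K" "K \<subseteq> sphere 0 1" and f: "continuous_on K f" and k0: "k0 \<in> K"
    and M: "0 < w_seminorm K f" and y: "v_seminorm k0 y \<le> 1"
    and c: "0 < c" "v_seminorm k0 (f k0 + c *\<^sub>R y) < w_seminorm K f" and r: "0 < r"
  obtains g where "continuous_on K g" "g k0 = y" "w_seminorm K g \<le> 1"
    "\<And>k. r \<le> dist k k0 \<Longrightarrow> g k = - (1 / w_seminorm K f) *\<^sub>R f k"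
    "\<not> w_orthogonal K f g"
proof -
  let ?M = "w_seminorm K f"
  have unit: "norm k = 1" if "k \<in> K" for k using K(2) that by auto
  have f_le: "v_seminorm k (f k) \<le> ?M" if "k \<in> K" for k
    using v_seminorm_le_w_seminorm[OF K f that] .
  obtain \<alpha> where \<alpha>: "continuous_on K \<alpha>" "\<alpha> k0 = 1"
    "\<And>k. k \<in> K \<Longrightarrow> 1 / max 1 (norm y) \<le> \<alpha> k" "\<And>k. k \<in> K \<Longrightarrow> \<alpha> k \<le> 1"
    "\<And>k. k \<in> K \<Longrightarrow> \<alpha> k * v_seminorm k y \<le> 1"
    using continuous_damping[OF K(2) k0 y] by blast
  define b where "b = 1 / max 1 (norm y)"
  have b: "0 < b" by (simp add: b_def)
  define \<delta> where "\<delta> = (?M - v_seminorm k0 (f k0 + c *\<^sub>R y)) / 2"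
  have \<delta>: "0 < \<delta>" "v_seminorm k0 (f k0 + c *\<^sub>R y) < ?M - \<delta>" using c(2) by (auto simp: \<delta>_def field_simps)
  have "continuous_on K (\<lambda>k. f k + c *\<^sub>R y)"
    by (intro continuous_intros f)
  from v_seminorm_upper_semicontinuous[OF K(2) this k0 \<delta>(2)]
  obtain r0 where r0: "0 < r0"
    "\<And>k. k \<in> K \<Longrightarrow> k \<noteq> k0 \<Longrightarrow> dist k k0 < r0 \<Longrightarrow> v_seminorm k (f k + c *\<^sub>R y) < ?M - \<delta>"
    by (auto simp: eventually_at)
  define r' where "r' = min r r0"
  have r': "0 < r'" "r' \<le> r" using r r0(1) by (auto simp: r'_def)
  have small: "v_seminorm k (f k + c *\<^sub>R y) \<le> ?M - \<delta>" if "k \<in> K" "dist k k0 < r'" for k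
    using r0(2)[OF that(1)] \<delta>(2) that(2) by (cases "k = k0") (auto simp: r'_def)
  define \<rho> where "\<rho> k = max 0 (1 - dist k k0 / r')" for k
  have \<rho>: "0 \<le> \<rho> k" "\<rho> k \<le> 1" for k using r' by (auto simp: \<rho>_def)
  have \<rho>0: "\<rho> k = 0" if "r' \<le> dist k k0" for k using that r' by (simp add: \<rho>_def)
  define g where "g k = (\<rho> k * \<alpha> k) *\<^sub>R y + ((1 - \<rho> k) / ?M) *\<^sub>R (- f k)" for k
  have ne: "K \<noteq> {}" using k0 by auto
  have \<alpha>_pos: "0 < \<alpha> k" if "k \<in> K" for k
    using \<alpha>(3)[OF that] b unfolding b_def by linarith
  have g: "continuous_on K g"
    unfolding g_def \<rho>_def using r' M by (intro continuous_intros \<alpha>(1) f) auto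
  have g_le: "w_seminorm K g \<le> 1"
  proof (rule w_seminorm_least[OF K(2) ne])
    fix k assume k: "k \<in> K"
    have "v_seminorm k (g k) \<le> \<rho> k * \<alpha> k * v_seminorm k y + (1 - \<rho> k) / ?M * v_seminorm k (- f k)"
      unfolding g_def using \<rho> \<alpha>_pos[OF k] M
      by (intro v_seminorm_combination unit[OF k]) (auto simp: less_imp_le)
    also have "\<dots> \<le> \<rho> k * 1 + (1 - \<rho> k) / ?M * ?M"
      using \<alpha>(5)[OF k] f_le[OF k] \<rho>[of k] M unfolding v_seminorm_minus[OF unit[OF k]] mult.assoc
      by (intro add_mono mult_left_mono) auto
    finally show "v_seminorm k (g k) \<le> 1" using M by simp
  qed
  define t where "t = min c ?M"
  have t: "0 < t" "t \<le> c" "t \<le> ?M" using c M by (auto simp: t_def)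
  define \<eta> where "\<eta> = t * min 1 (b * \<delta> / c)"
  have \<eta>: "0 < \<eta>" using t b \<delta>(1) c by (simp add: \<eta>_def)
  have "w_seminorm K (\<lambda>k. f k + t *\<^sub>R g k) \<le> ?M - \<eta>"
  proof (rule w_seminorm_least[OF K(2) ne])
    fix k assume k: "k \<in> K"
    \<comment> \<open>\<open>f + t g = (1 - p - q) f + p (f + c y)\<close>, where \<open>q\<close> comes from the part of \<open>g\<close> along \<open>f\<close>\<close>
    define p where "p = t / c * (\<rho> k * \<alpha> k)"
    define q where "q = t / ?M * (1 - \<rho> k)"
    have p: "0 \<le> p" using t c \<rho>(1)[of k] \<alpha>_pos[OF k] by (simp add: p_def)
    have "p \<le> 1 * (\<rho> k * 1)"
      unfolding p_def using t c \<rho>(1)[of k] \<alpha>_pos[OF k] \<alpha>(4)[OF k]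
      by (intro mult_mono) (auto simp: less_imp_le)
    moreover have "q \<le> 1 * (1 - \<rho> k)"
      unfolding q_def using t M \<rho>(2)[of k] by (intro mult_right_mono) auto
    ultimately have pq: "p + q \<le> 1" by simp
    have "f k + t *\<^sub>R g k = (1 - p - q) *\<^sub>R f k + p *\<^sub>R (f k + c *\<^sub>R y)"
      using c by (simp add: g_def p_def q_def algebra_simps)
    then have "v_seminorm k (f k + t *\<^sub>R g k)
        \<le> (1 - p - q) * v_seminorm k (f k) + p * v_seminorm k (f k + c *\<^sub>R y)"
      using v_seminorm_combination[OF unit[OF k], of "1 - p - q" p] p pq by simp
    also have "\<dots> \<le> (1 - p - q) * ?M + p * (?M - \<delta>)"
    proof (rule add_mono)
      show "p * v_seminorm k (f k + c *\<^sub>R y) \<le> p * (?M - \<delta>)"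
      proof (cases "dist k k0 < r'")
        case True
        then show ?thesis using small[OF k] p by (simp add: mult_left_mono)
      next
        case False
        then show ?thesis using \<rho>0[of k] by (simp add: p_def)
      qed
    qed (use f_le[OF k] pq in \<open>auto intro: mult_left_mono\<close>)
    also have "\<dots> = ?M - (q * ?M + p * \<delta>)" by (simp add: algebra_simps)
    also have "\<dots> \<le> ?M - \<eta>"
    proof -
      let ?m = "min 1 (b * \<delta> / c)"
      have "?m = (1 - \<rho> k) * ?m + \<rho> k * ?m" by (simp add: algebra_simps)
      also have "\<dots> \<le> (1 - \<rho> k) * 1 + \<rho> k * (\<alpha> k * \<delta> / c)"
        using \<rho>[of k] \<alpha>(3)[OF k] \<delta>(1) c(1) unfolding b_def[symmetric]
        by (intro add_mono mult_left_mono) (auto simp: min_le_iff_disj divide_right_mono mult_right_mono)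
      finally have "t * ?m \<le> t * ((1 - \<rho> k) + \<rho> k * (\<alpha> k * \<delta> / c))"
        using t(1) by simp
      also have "\<dots> = q * ?M + p * \<delta>"
        using M c(1) by (simp add: p_def q_def field_simps)
      finally show ?thesis by (simp add: \<eta>_def)
    qed
    finally show "v_seminorm k (f k + t *\<^sub>R g k) \<le> ?M - \<eta>" .
  qed
  then have "\<not> w_orthogonal K f g"
    using \<eta> unfolding w_orthogonal_def by (auto simp: not_le intro!: exI[of _ t])
  moreover have "g k0 = y" using \<alpha>(2) by (simp add: g_def \<rho>_def)
  moreover have "g k = - (1 / ?M) *\<^sub>R f k" if "r \<le> dist k k0" for k
    using \<rho>0[of k] that r' by (simp add: g_def)
  ultimately show thesis using that g g_le by blast
qed

text \<open>
  If \<open>k0\<close> is not norming, \<open>descent_direction\<close> applies with \<open>y = \<sigma> k0\<close>, where \<open>\<sigma>\<close> is the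
  sign of \<open>\<phi> (f k0)\<close> for some support functional \<open>\<phi>\<close> of \<open>k0\<close>.  A positive multiple of
  \<open>f\<close> does not push \<open>\<phi> (g k0) = \<sigma>\<close> towards 0.  A negative multiple increases the size of
  \<open>g\<close> at a norming point \<open>k1\<close>; by upper semicontinuity such points keep a distance from \<open>k0\<close>, so
  that \<open>g k1 = - f k1 / M\<close>.
\<close>

lemma nr_right_symmetric_norming:
  fixes K :: "'a::real_normed_vector set"
  assumes K: "compact K" "K \<subseteq> sphere 0 1" and f: "continuous_on K f"
    and nr: "nr_right_symmetric K f" and k0: "k0 \<in> K"
  shows "v_seminorm k0 (f k0) = w_seminorm K f"
proof (rule ccontr)
  let ?M = "w_seminorm K f"
  assume "v_seminorm k0 (f k0) \<noteq> ?M"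
  then have less: "v_seminorm k0 (f k0) < ?M"
    using v_seminorm_le_w_seminorm[OF K f k0] by simp
  have u0: "norm k0 = 1" using K(2) k0 by auto
  have M: "0 < ?M" using less v_seminorm_nonneg[OF u0, of "f k0"] by simp
  obtain \<phi> where \<phi>: "\<phi> \<in> J k0" using J_nonempty[OF u0] by blast
  define \<sigma> :: real where "\<sigma> = (if 0 \<le> blinfun_apply \<phi> (f k0) then 1 else - 1)"
  have \<sigma>: "\<bar>\<sigma>\<bar> = 1" "0 \<le> \<sigma> * blinfun_apply \<phi> (f k0)" "\<sigma> * \<sigma> = 1" by (auto simp: \<sigma>_def)
  have v\<sigma>: "v_seminorm k0 (\<sigma> *\<^sub>R k0) \<le> 1"
    using v_seminorm_le_norm[OF u0, of "\<sigma> *\<^sub>R k0"] \<sigma>(1) u0 by simp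
  define c where "c = (?M - v_seminorm k0 (f k0)) / 2"
  have c: "0 < c" "v_seminorm k0 (f k0) + c < ?M" using less by (auto simp: c_def field_simps)
  have "v_seminorm k0 (f k0 + c *\<^sub>R (\<sigma> *\<^sub>R k0)) \<le> v_seminorm k0 (f k0) + c * v_seminorm k0 (\<sigma> *\<^sub>R k0)"
    using v_seminorm_combination[OF u0, of 1 c "f k0" "\<sigma> *\<^sub>R k0"] c(1) by simp
  also have "\<dots> \<le> v_seminorm k0 (f k0) + c * 1"
    using v\<sigma> c(1) by (intro add_left_mono mult_left_mono) auto
  also have "\<dots> < ?M" using c(2) by simp
  finally have desc: "v_seminorm k0 (f k0 + c *\<^sub>R (\<sigma> *\<^sub>R k0)) < ?M" .
  have "\<forall>\<^sub>F k in at k0 within K. v_seminorm k (f k) < ?M"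
    by (rule v_seminorm_upper_semicontinuous[OF K(2) f k0 less])
  then obtain r where r: "0 < r"
    "\<And>k. k \<in> K \<Longrightarrow> k \<noteq> k0 \<Longrightarrow> dist k k0 < r \<Longrightarrow> v_seminorm k (f k) < ?M"
    by (auto simp: eventually_at)
  obtain k1 where k1: "k1 \<in> K" "v_seminorm k1 (f k1) = ?M"
    using w_seminorm_attained[OF K _ f] k0 by blast
  have u1: "norm k1 = 1" using K(2) k1 by auto
  have far: "r \<le> dist k1 k0" using r(2)[OF k1(1)] k1(2) less by force
  obtain g where g: "continuous_on K g" "g k0 = \<sigma> *\<^sub>R k0" "w_seminorm K g \<le> 1"
    "\<And>k. r \<le> dist k k0 \<Longrightarrow> g k = - (1 / ?M) *\<^sub>R f k" "\<not> w_orthogonal K f g"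
    using descent_direction[OF K f k0 M v\<sigma> c(1) desc r(1)] by blast
  have "w_orthogonal K g f"
    unfolding w_orthogonal_def
  proof
    fix s :: real
    have v_le: "v_seminorm k (g k + s *\<^sub>R f k) \<le> w_seminorm K (\<lambda>k. g k + s *\<^sub>R f k)" if "k \<in> K" for k
      by (intro v_seminorm_le_w_seminorm K that continuous_intros f g)
    have "1 \<le> w_seminorm K (\<lambda>k. g k + s *\<^sub>R f k)"
    proof (cases "0 \<le> s")
      case True
      have "1 \<le> \<sigma> * blinfun_apply \<phi> (\<sigma> *\<^sub>R k0 + s *\<^sub>R f k0)"
        using \<sigma>(2,3) True J_bounds(1)[OF \<phi>] mult_nonneg_nonneg[OF True \<sigma>(2)]
        by (simp add: blinfun.add_right blinfun.scaleR_right algebra_simps)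
      also have "\<dots> \<le> \<bar>blinfun_apply \<phi> (\<sigma> *\<^sub>R k0 + s *\<^sub>R f k0)\<bar>"
        by (auto simp: \<sigma>_def)
      also have "\<dots> \<le> v_seminorm k0 (g k0 + s *\<^sub>R f k0)"
        using abs_le_v_seminorm[OF \<phi>] by (simp add: g(2))
      finally show ?thesis using v_le[OF k0] by simp
    next
      case False
      have "g k1 + s *\<^sub>R f k1 = (s - 1 / ?M) *\<^sub>R f k1"
        using g(4)[OF far] by (simp add: algebra_simps)
      then have "v_seminorm k1 (g k1 + s *\<^sub>R f k1) = \<bar>s - 1 / ?M\<bar> * ?M"
        by (simp add: v_seminorm_scale[OF u1] k1(2))
      also have "\<bar>s - 1 / ?M\<bar> = 1 / ?M - s"
        using False divide_pos_pos[OF zero_less_one M] by linarith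
      also have "(1 / ?M - s) * ?M = 1 - s * ?M"
        using M by (simp add: algebra_simps)
      finally show ?thesis
        using v_le[OF k1(1)] False M mult_nonpos_nonneg[of s ?M] by simp
    qed
    then show "w_seminorm K g \<le> w_seminorm K (\<lambda>k. g k + s *\<^sub>R f k)" using g(3) by simp
  qed
  then show False using nr g(1,5) by (simp add: nr_right_symmetric_def)
qed

text \<open>
  If \<open>y\<close> is orthogonal to \<open>f k0\<close> but not conversely, the direction \<open>z\<close> of \<open>y\<close> that shortens
  \<open>f k0\<close>, normalised, extends to a function \<open>g\<close> with \<open>w_seminorm K g = 1\<close> that is orthogonal to
  \<open>f\<close> because of the point \<open>k0\<close> alone.
\<close>

lemma nr_right_symmetric_pointwise:
  fixes K :: "'a::real_normed_vector set"
  assumes K: "compact K" "K \<subseteq> sphere 0 1" and f: "continuous_on K f"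
    and nr: "nr_right_symmetric K f" and k0: "k0 \<in> K"
  shows "v_right_symmetric k0 (f k0)"
  unfolding v_right_symmetric_def
proof (intro allI impI)
  fix y assume orth: "v_orthogonal k0 y (f k0)"
  let ?M = "w_seminorm K f"
  let ?v = "v_seminorm k0"
  have u0: "norm k0 = 1" using K(2) k0 by auto
  have M: "?v (f k0) = ?M" by (rule nr_right_symmetric_norming[OF K f nr k0])
  show "v_orthogonal k0 (f k0) y"
    unfolding v_orthogonal_def
  proof (rule ccontr)
    assume "\<not> (\<forall>c. ?v (f k0) \<le> ?v (f k0 + c *\<^sub>R y))"
    then obtain c where c: "?v (f k0 + c *\<^sub>R y) < ?M" using M by (auto simp: not_le)
    have Mpos: "0 < ?M" using c v_seminorm_nonneg[OF u0, of "f k0 + c *\<^sub>R y"] by simp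
    have "?M \<le> ?v (f k0 + c *\<^sub>R y) + \<bar>c\<bar> * ?v y"
      using v_seminorm_triangle[OF u0, of "f k0 + c *\<^sub>R y" "- (c *\<^sub>R y)"] M
      by (simp add: v_seminorm_minus[OF u0] v_seminorm_scale[OF u0])
    then have cy: "0 < \<bar>c\<bar> * ?v y" using c by simp
    then have c0: "c \<noteq> 0" and vy: "0 < ?v y"
      using v_seminorm_nonneg[OF u0, of y] by (auto simp: zero_less_mult_iff)
    define z where "z = (sgn c / ?v y) *\<^sub>R y"
    have vz: "?v z = 1"
      using c0 vy by (simp add: z_def v_seminorm_scale[OF u0] abs_sgn_eq)
    have cz: "c *\<^sub>R y = (\<bar>c\<bar> * ?v y) *\<^sub>R z"
      using vy by (simp add: z_def abs_sgn_eq sgn_mult abs_mult_sgn mult.assoc mult_sgn_abs)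
    have desc: "?v (f k0 + (\<bar>c\<bar> * ?v y) *\<^sub>R z) < ?M"
      using c cz by simp
    obtain g where g: "continuous_on K g" "g k0 = z" "w_seminorm K g \<le> 1" "\<not> w_orthogonal K f g"
      using descent_direction[OF K f k0 Mpos eq_refl[OF vz] cy desc zero_less_one] by blast
    have "w_orthogonal K g f"
      unfolding w_orthogonal_def
    proof
      fix s
      define a where "a = sgn c / ?v y"
      have a: "a \<noteq> 0" using c0 vy by (simp add: a_def sgn_zero_iff)
      have "z + s *\<^sub>R f k0 = a *\<^sub>R (y + (s / a) *\<^sub>R f k0)"
        using a by (simp add: z_def a_def[symmetric] scaleR_add_right)
      then have "?v (z + s *\<^sub>R f k0) = \<bar>a\<bar> * ?v (y + (s / a) *\<^sub>R f k0)"
        by (simp add: v_seminorm_scale[OF u0])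
      moreover have "?v y \<le> ?v (y + (s / a) *\<^sub>R f k0)"
        using orth by (simp add: v_orthogonal_def)
      moreover have "1 = \<bar>a\<bar> * ?v y"
        using vz by (simp add: z_def a_def[symmetric] v_seminorm_scale[OF u0])
      ultimately have "1 \<le> ?v (g k0 + s *\<^sub>R f k0)"
        using mult_left_mono[of "?v y" "?v (y + (s / a) *\<^sub>R f k0)" "\<bar>a\<bar>"] by (simp add: g(2))
      also have "\<dots> \<le> w_seminorm K (\<lambda>k. g k + s *\<^sub>R f k)"
        by (intro v_seminorm_le_w_seminorm K k0 continuous_intros f g)
      finally show "w_seminorm K g \<le> w_seminorm K (\<lambda>k. g k + s *\<^sub>R f k)" using g(3) by simp
    qed
    then show False using nr g(1,4) by (simp add: nr_right_symmetric_def)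
  qed
qed

theorem theorem1p3:
  fixes K :: "'a::banach set" and f :: "'a \<Rightarrow> 'a"
  assumes "compact K" and "K \<subseteq> sphere 0 1" and "continuous_on K f"
  shows "nr_right_symmetric K f \<longleftrightarrow>
    (\<forall>k\<in>K. (\<exists>\<phi>\<in>J k. \<bar>blinfun_apply \<phi> (f k)\<bar> = w_seminorm K f) \<and>
            v_right_symmetric k (f k))"
proof (cases "K = {}")
  case True
  then show ?thesis
    by (simp add: nr_right_symmetric_def w_orthogonal_def w_seminorm_def Pi_pairs_def)
next
  case False
  have norming: "(\<exists>\<phi>\<in>J k. \<bar>blinfun_apply \<phi> (f k)\<bar> = w_seminorm K f) \<longleftrightarrow>
      v_seminorm k (f k) = w_seminorm K f" if k: "k \<in> K" for k
  proof -
    have "norm k = 1" using assms(2) k by auto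
    then obtain \<psi> where "\<psi> \<in> J k" "\<bar>blinfun_apply \<psi> (f k)\<bar> = v_seminorm k (f k)"
      using v_seminorm_attained by blast
    then show ?thesis
      using abs_le_v_seminorm[of _ k "f k"] v_seminorm_le_w_seminorm[OF assms k]
      by (metis order_antisym)
  qed
  show ?thesis
    using nr_right_symmetric_if_pointwise[OF assms(1,2) False assms(3)]
      nr_right_symmetric_norming[OF assms] nr_right_symmetric_pointwise[OF assms] norming
    by blast
qed

end
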